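(* The worst-case approximation guarantee of the local greedy policy for the two-period problem is $O(1/n)$, where $n$ is the size of the market. That is, there is a constant $C>0$ such that for all sufficiently large $n$ there is an instance of the two-period problem with $n$ users and $\mathrm{OPT}>0$ on which the expected total number of matches of the local greedy policy is at most $\frac{C}{n}\,\mathrm{OPT}$.
   Context: Setting. $I$ and $J$ are finite disjoint sets of users; the size of the market is the number of users up to constant factors. Each $\ell\in I\cup J$ has a positive integer $K_\ell$ and an initial set of potentials $P^1_\ell$, with $P^1_i\subseteq J$, $P^1_j\subseteq I$ and $\ell'\in P^1_\ell$ iff $\ell\in P^1_{\ell'}$. Let $E=\{\{i,j\}:i\in I,j\in P^1_i\}$, $\vec E=\{(\ell,\ell'):\ell\in I\cup J,\ell'\in P^1_\ell\}$. If $\ell'$ is shown to $\ell$ in period $t\in\{1,2\}$, $\ell$ likes $\ell'$ with probability $\phi^t_{\ell,\ell'}$; like decisions are independent. $\beta^t_e=\phi^t_{\ell,\ell'}\phi^t_{\ell',\ell}$ for $e=\{\ell,\ell'\}$. Initial backlogs are empty. A match occurs when two users see and like each other, possibly in different periods. After period 1, $P^2_\ell$ is $P^1_\ell$ minus the profiles shown to $\ell$ and the users who disliked $\ell$ in period 1, and the backlog $B^2_\ell$ is the set of users in $P^2_\ell$ who liked $\ell$ in period 1 ($B^1_\ell=\emptyset$). Two-period problem and $\mathrm{OPT}$. For $R\subseteq\vec E$ let $f(R)=\max\{\sum_{(\ell,\ell')\in\vec E}\phi^2_{\ell,\ell'}x^2_{\ell,\ell'}:\ \mathbf x^2\in\{0,1\}^{\vec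 E},\ \sum_{\ell'\in P^1_\ell}x^2_{\ell,\ell'}\le K_\ell\ \forall\ell,\ x^2_{\ell,\ell'}\le\mathbf 1_{\{(\ell',\ell)\in R\}}\}$ and $\mathsf M^2(\mathbf x,\mathbf w)=\sum_{R\subseteq\vec E}f(R)\prod_{a\in R}\phi^1_ax_a\prod_{a\notin R}(1-\phi^1_ax_a)$. $\mathrm{OPT}$ is the maximum of $\sum_{e\in E}\beta^1_ew_e+\mathsf M^2(\mathbf x,\mathbf w)$ over $\mathbf x\in\{0,1\}^{\vec E}$, $\mathbf w\in\{0,1\}^E$ with $\sum_{\ell'\in P^1_\ell}x_{\ell,\ell'}+\sum_{e\ni\ell}w_e\le K_\ell$ for all $\ell$ and $x_{\ell,\ell'}+x_{\ell',\ell}+w_e\le1$ for all $e=\{\ell,\ell'\}\in E$. Local greedy policy: in each period $t$ and for each user $\ell$ separately, show $$S^t_\ell\in\arg\max_{S\subseteq P^t_\ell:\,|S|\le K_\ell}\ \sum_{\ell'\in S}\phi^t_{\ell,\ell'}\big(\mathbf 1_{\{\ell'\in B^t_\ell\}}+\phi^t_{\ell',\ell}\mathbf 1_{\{\ell'\notin B^t_\ell\}}\big).$$ *)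

theory Defs
  imports "HOL-Probability.Probability"
begin

text \<open>An instance: the two sides, the display capacities \<open>K\<close>, the initial potentials \<open>P\<^sup>1\<close> and
  the like probabilities, where \<open>phi M t (l, l')\<close> is the probability that \<open>l\<close> likes \<open>l'\<close> when
  \<open>l'\<close> is shown to \<open>l\<close> in period \<open>t\<close>. Only the periods 1 and 2 are relevant.\<close>

record 'a market =
  sideI :: "'a set"
  sideJ :: "'a set"
  cap :: "'a \<Rightarrow> nat"
  pot1 :: "'a \<Rightarrow> 'a set"
  phi :: "nat \<Rightarrow> 'a \<times> 'a \<Rightarrow> real"

definition users :: "'a market \<Rightarrow> 'a set" where
  "users M = sideI M \<union> sideJ M"

definition arcs :: "'a market \<Rightarrow> ('a \<times> 'a) set" where
  "arcs M = {(l, l'). l \<in> users M \<and> l' \<in> pot1 M l}"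

definition edges :: "'a market \<Rightarrow> 'a set set" where
  "edges M = {{i, j} | i j. i \<in> sideI M \<and> j \<in> pot1 M i}"

definition valid_market :: "'a market \<Rightarrow> bool" where
  "valid_market M \<longleftrightarrow>
     finite (sideI M) \<and> finite (sideJ M) \<and> sideI M \<inter> sideJ M = {} \<and>
     (\<forall>l\<in>users M. 0 < cap M l) \<and>
     (\<forall>i\<in>sideI M. pot1 M i \<subseteq> sideJ M) \<and>
     (\<forall>j\<in>sideJ M. pot1 M j \<subseteq> sideI M) \<and>
     (\<forall>l\<in>users M. \<forall>l'\<in>users M. l' \<in> pot1 M l \<longleftrightarrow> l \<in> pot1 M l') \<and>
     (\<forall>t\<in>{1, 2}. \<forall>a\<in>arcs M. 0 \<le> phi M t a \<and> phi M t a \<le> 1)"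

text \<open>The product ranges over the two orientations of \<open>e\<close>.\<close>

definition beta :: "'a market \<Rightarrow> nat \<Rightarrow> 'a set \<Rightarrow> real" where
  "beta M t e = (\<Prod>a \<in> {(l, l') \<in> arcs M. {l, l'} = e}. phi M t a)"


subsection \<open>The benchmark\<close>

text \<open>Zero-one vectors are extensional functions into \<open>{0, 1}\<close>, so all feasible sets are finite.\<close>

definition feasible2 :: "'a market \<Rightarrow> ('a \<times> 'a) set \<Rightarrow> ('a \<times> 'a \<Rightarrow> real) set" where
  "feasible2 M R = {x2 \<in> arcs M \<rightarrow>\<^sub>E {0, 1}.
     (\<forall>l\<in>users M. (\<Sum>l'\<in>pot1 M l. x2 (l, l')) \<le> real (cap M l)) \<and>
     (\<forall>(l, l')\<in>arcs M. x2 (l, l') \<le> of_bool ((l', l) \<in> R))}"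

definition second_period_value :: "'a market \<Rightarrow> ('a \<times> 'a) set \<Rightarrow> real" where
  "second_period_value M R = Max ((\<lambda>x2. \<Sum>a\<in>arcs M. phi M 2 a * x2 a) ` feasible2 M R)"

text \<open>This depends on \<open>x\<close> only: backlogs are created by the one-sided displays.\<close>

definition M2 :: "'a market \<Rightarrow> ('a \<times> 'a \<Rightarrow> real) \<Rightarrow> real" where
  "M2 M x = (\<Sum>R\<in>Pow (arcs M). second_period_value M R *
     (\<Prod>a\<in>R. phi M 1 a * x a) * (\<Prod>a\<in>arcs M - R. 1 - phi M 1 a * x a))"

definition feasible1 :: "'a market \<Rightarrow> (('a \<times> 'a \<Rightarrow> real) \<times> ('a set \<Rightarrow> real)) set" where
  "feasible1 M = {(x, w). x \<in> arcs M \<rightarrow>\<^sub>E {0, 1} \<and> w \<in> edges M \<rightarrow>\<^sub>E {0, 1} \<and>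
     (\<forall>l\<in>users M. (\<Sum>l'\<in>pot1 M l. x (l, l')) + (\<Sum>e\<in>{e \<in> edges M. l \<in> e}. w e)
        \<le> real (cap M l)) \<and>
     (\<forall>(l, l')\<in>arcs M. x (l, l') + x (l', l) + w {l, l'} \<le> 1)}"

definition OPT :: "'a market \<Rightarrow> real" where
  "OPT M = Max ((\<lambda>(x, w). (\<Sum>e\<in>edges M. beta M 1 e * w e) + M2 M x) ` feasible1 M)"


subsection \<open>Two-period policies and the local greedy policy\<close>

text \<open>A policy is a pair \<open>(S1, S2)\<close>: \<open>S1 l\<close> is shown to \<open>l\<close> in period 1, and \<open>S2 R l\<close> is shown
  to \<open>l\<close> in period 2 if \<open>R\<close> is the set of pairs \<open>(l, l')\<close> such that \<open>l\<close> was shown \<open>l'\<close> in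
  period 1 and liked it.\<close>

definition shown :: "'a market \<Rightarrow> ('a \<Rightarrow> 'a set) \<Rightarrow> ('a \<times> 'a) set" where
  "shown M S = {(l, l'). l \<in> users M \<and> l' \<in> S l}"

definition pot2 :: "'a market \<Rightarrow> ('a \<Rightarrow> 'a set) \<Rightarrow> ('a \<times> 'a) set \<Rightarrow> 'a \<Rightarrow> 'a set" where
  "pot2 M S1 R l = pot1 M l - S1 l - {l'. (l', l) \<in> shown M S1 \<and> (l', l) \<notin> R}"

definition backlog2 :: "'a market \<Rightarrow> ('a \<Rightarrow> 'a set) \<Rightarrow> ('a \<times> 'a) set \<Rightarrow> 'a \<Rightarrow> 'a set" where
  "backlog2 M S1 R l = {l' \<in> pot2 M S1 R l. (l', l) \<in> R}"

definition greedy_value :: "'a market \<Rightarrow> nat \<Rightarrow> 'a set \<Rightarrow> 'a \<Rightarrow> 'a set \<Rightarrow> real" where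
  "greedy_value M t B l S =
     (\<Sum>l'\<in>S. phi M t (l, l') * (of_bool (l' \<in> B) + phi M t (l', l) * of_bool (l' \<notin> B)))"

definition greedy_choice ::
    "'a market \<Rightarrow> nat \<Rightarrow> 'a set \<Rightarrow> 'a set \<Rightarrow> 'a \<Rightarrow> 'a set \<Rightarrow> bool" where
  "greedy_choice M t P B l S \<longleftrightarrow>
     is_arg_max (greedy_value M t B l) (\<lambda>S. S \<subseteq> P \<and> card S \<le> cap M l) S"

text \<open>Ties may be broken arbitrarily, in period 2 even depending on the whole history.\<close>

definition local_greedy ::
    "'a market \<Rightarrow> ('a \<Rightarrow> 'a set) \<Rightarrow> (('a \<times> 'a) set \<Rightarrow> 'a \<Rightarrow> 'a set) \<Rightarrow> bool" where
  "local_greedy M S1 S2 \<longleftrightarrow>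
     (\<forall>l\<in>users M. greedy_choice M 1 (pot1 M l) {} l (S1 l)) \<and>
     (\<forall>R\<subseteq>shown M S1. \<forall>l\<in>users M.
        greedy_choice M 2 (pot2 M S1 R l) (backlog2 M S1 R l) l (S2 R l))"

text \<open>\<open>\<omega> (t, l, l')\<close> says whether \<open>l\<close> likes \<open>l'\<close> if \<open>l'\<close> is shown to \<open>l\<close> in period \<open>t\<close>.\<close>

definition like_pmf :: "'a market \<Rightarrow> (nat \<times> 'a \<times> 'a \<Rightarrow> bool) pmf" where
  "like_pmf M = Pi_pmf ({1, 2} \<times> arcs M) False (\<lambda>(t, a). bernoulli_pmf (phi M t a))"

definition likes ::
    "'a market \<Rightarrow> (nat \<times> 'a \<times> 'a \<Rightarrow> bool) \<Rightarrow> nat \<Rightarrow> ('a \<Rightarrow> 'a set) \<Rightarrow> ('a \<times> 'a) set" where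
  "likes M \<omega> t S = {a \<in> shown M S. \<omega> (t, a)}"

definition matches ::
    "'a market \<Rightarrow> ('a \<Rightarrow> 'a set) \<Rightarrow> (('a \<times> 'a) set \<Rightarrow> 'a \<Rightarrow> 'a set) \<Rightarrow>
     (nat \<times> 'a \<times> 'a \<Rightarrow> bool) \<Rightarrow> 'a set set" where
  "matches M S1 S2 \<omega> =
     (let L1 = likes M \<omega> 1 S1; L = L1 \<union> likes M \<omega> 2 (S2 L1)
      in {{l, l'} | l l'. (l, l') \<in> L \<and> (l', l) \<in> L})"

definition expected_matches ::
    "'a market \<Rightarrow> ('a \<Rightarrow> 'a set) \<Rightarrow> (('a \<times> 'a) set \<Rightarrow> 'a \<Rightarrow> 'a set) \<Rightarrow> real" where
  "expected_matches M S1 S2 =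
     measure_pmf.expectation (like_pmf M) (\<lambda>\<omega>. real (card (matches M S1 S2 \<omega>)))"

lemma greedy_choice_exists:
  assumes "finite P"
  shows "\<exists>S. greedy_choice M t P B l S"
proof -
  let ?A = "{S. S \<subseteq> P \<and> card S \<le> cap M l}"
  have "finite ?A" using assms by simp
  moreover have "{} \<in> ?A" by simp
  ultimately obtain S where "is_arg_min (\<lambda>S. - greedy_value M t B l S) (\<lambda>S. S \<in> ?A) S"
    using ex_is_arg_min_if_finite[of ?A] by blast
  then have "greedy_choice M t P B l S"
    by (simp add: greedy_choice_def is_arg_max_def is_arg_min_def)
  then show ?thesis ..
qed

lemma local_greedy_exists:
  assumes "valid_market M"
  shows "\<exists>S1 S2. local_greedy M S1 S2"
proof -
  have fin: "finite (pot1 M l)" if "l \<in> users M" for l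
    using assms that unfolding valid_market_def users_def by (meson UnE finite_subset)
  have "\<forall>l\<in>users M. \<exists>S. greedy_choice M 1 (pot1 M l) {} l S"
    using greedy_choice_exists[OF fin] by simp
  from bchoice[OF this] obtain S1
    where S1: "\<forall>l\<in>users M. greedy_choice M 1 (pot1 M l) {} l (S1 l)" ..
  have fin2: "finite (pot2 M S1 R l)" if "l \<in> users M" for R l
    using fin[OF that] by (simp add: pot2_def)
  have "greedy_choice M 2 (pot2 M S1 R l) (backlog2 M S1 R l) l
      (SOME S. greedy_choice M 2 (pot2 M S1 R l) (backlog2 M S1 R l) l S)"
    if "l \<in> users M" for R l
    by (rule someI_ex, rule greedy_choice_exists, rule fin2, rule that)
  with S1 have "local_greedy M S1
      (\<lambda>R l. SOME S. greedy_choice M 2 (pot2 M S1 R l) (backlog2 M S1 R l) l S)"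
    by (simp add: local_greedy_def)
  then show ?thesis by blast
qed

end

theory Submission
  imports Defs
begin

text \<open>One popular user 0 on side \<open>J\<close>, of capacity 1, is strictly preferred by every user of side
  \<open>I\<close> to all other users of \<open>J\<close>. Local greedy then shows 0 to all of \<open>I\<close>, but 0 sees only one
  of them. Since nobody likes anybody in period 2, this leaves at most one match, whereas the
  benchmark shows the pairs of a matching of linear size to each other in period 1.\<close>

definition popular_market :: "nat \<Rightarrow> nat \<Rightarrow> nat market" where
  "popular_market m n = \<lparr>sideI = {1..m}, sideJ = insert 0 {m<..<n}, cap = (\<lambda>_. 1),
     pot1 = (\<lambda>l. if l \<in> {1..m} then insert 0 {m<..<n} else {1..m}),
     phi = (\<lambda>t (l, l'). if t = 1 then if l \<in> {1..m} \<and> l' \<noteq> 0 then 1/2 else 1 else 0)\<rparr>"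

lemma popular_market_simps [simp]:
  "sideI (popular_market m n) = {1..m}"
  "sideJ (popular_market m n) = insert 0 {m<..<n}"
  "cap (popular_market m n) l = 1"
  "pot1 (popular_market m n) l = (if l \<in> {1..m} then insert 0 {m<..<n} else {1..m})"
  "phi (popular_market m n) t (l, l') =
     (if t = 1 then if l \<in> {1..m} \<and> l' \<noteq> 0 then 1/2 else 1 else 0)"
  by (simp_all add: popular_market_def)

text \<open>The labelling is chosen so that the total size is \<open>n\<close> for every
  \<open>m < n\<close>: side \<open>J\<close> absorbs whatever side \<open>I\<close> leaves over, so
  both parities of \<open>n\<close> can be realised.\<close>

lemma users_popular_market: "m < n \<Longrightarrow> users (popular_market m n) = {..<n}"
  by (auto simp: users_def)

lemma phi_popular_market_2: "phi (popular_market m n) 2 a = 0"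
  by (cases a) simp

lemma valid_popular_market: "valid_market (popular_market m n)"
  by (auto simp: valid_market_def users_def)

lemma finite_users: "valid_market M \<Longrightarrow> finite (users M)"
  by (simp add: valid_market_def users_def)

lemma arcs_subset: "valid_market M \<Longrightarrow> arcs M \<subseteq> users M \<times> users M"
  by (auto simp: valid_market_def users_def arcs_def)

lemma finite_arcs: "valid_market M \<Longrightarrow> finite (arcs M)"
  using finite_subset[OF arcs_subset] finite_users by blast

lemma edges_subset: "valid_market M \<Longrightarrow> edges M \<subseteq> Pow (users M)"
  by (auto simp: valid_market_def users_def edges_def)

lemma finite_edges: "valid_market M \<Longrightarrow> finite (edges M)"
  using finite_subset[OF edges_subset] finite_users by blast

text \<open>\<open>Max\<close> bounds the elements of a set only if the set is finite. Here
  finiteness comes from the vectors being extensional and zero-one valued.\<close>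

lemma finite_feasible1: "valid_market M \<Longrightarrow> finite (feasible1 M)"
  by (rule finite_subset[of _ "(arcs M \<rightarrow>\<^sub>E {0, 1}) \<times> (edges M \<rightarrow>\<^sub>E {0, 1})"])
     (auto simp: feasible1_def finite_arcs finite_edges intro!: finite_PiE)

lemma OPT_ge:
  assumes "valid_market M" "(x, w) \<in> feasible1 M"
  shows "(\<Sum>e\<in>edges M. beta M 1 e * w e) + M2 M x \<le> OPT M"
  unfolding OPT_def using assms by (intro Max_ge) (auto simp: finite_feasible1 intro!: rev_image_eqI)

text \<open>With all period 2 probabilities zero, the objective of the second-period problem
  vanishes at every feasible point, for every backlog \<open>R\<close>.\<close>

lemma M2_eq_0:
  assumes M: "valid_market M" and phi: "\<And>a. a \<in> arcs M \<Longrightarrow> phi M 2 a = 0"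
  shows "M2 M x = 0"
proof -
  have "second_period_value M R = 0" for R
  proof -
    \<comment> \<open>A feasible point is needed for the set of values to be exactly {0} rather than
      empty, where \<open>Max\<close> would be unspecified.\<close>
    have "restrict (\<lambda>_. 0) (arcs M) \<in> feasible2 M R"
      by (auto simp: feasible2_def arcs_def)
    then have "(\<lambda>x2. \<Sum>a\<in>arcs M. phi M 2 a * x2 a) ` feasible2 M R = {0}"
      using phi by (auto simp: image_iff)
    then show ?thesis by (simp add: second_period_value_def)
  qed
  then show ?thesis by (simp add: M2_def)
qed

text \<open>The disjoint pairs {i, i + m} with i in {1..m} are displayed to both endpoints in period
  1, and each becomes a match with probability 1/2. The bound 2m < n keeps i + m below n, hence on
  side \<open>J\<close>.\<close>

lemma OPT_popular_market_ge:
  assumes mn: "2 * m < n"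
  shows "real m / 2 \<le> OPT (popular_market m n)"
proof -
  let ?M = "popular_market m n"
  let ?g = "\<lambda>i. {i, i + m}"
  let ?G = "?g ` {1..m}"
  define w :: "nat set \<Rightarrow> real" where "w = restrict (\<lambda>e. of_bool (e \<in> ?G)) (edges ?M)"
  define x :: "nat \<times> nat \<Rightarrow> real" where "x = restrict (\<lambda>_. 0) (arcs ?M)"
  note V = valid_popular_market[of m n]
  have G: "?G \<subseteq> edges ?M" 
  proof (rule image_subsetI)
    fix i assume "i \<in> {1..m}"
    then have "i \<in> sideI ?M" "i + m \<in> pot1 ?M i" using mn by auto
    then show "?g i \<in> edges ?M" unfolding edges_def by blast
  qed
  have inj: "inj_on ?g {1..m}" by (auto simp: inj_on_def doubleton_eq_iff)
  have x0: "x (l, l') = 0" if "l \<in> users ?M" "l' \<in> pot1 ?M l" for l l'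
    using that by (simp add: x_def arcs_def)
  have cap: "(\<Sum>e\<in>{e \<in> edges ?M. l \<in> e}. w e) \<le> 1" for l
  proof -
    \<comment> \<open>The pairs form a matching: a label up to \<open>m\<close> can only be the
      smaller endpoint, and a label above \<open>m\<close> only the larger one.\<close>
    have "{e \<in> ?G. l \<in> e} \<subseteq> {if l \<le> m then ?g l else ?g (l - m)}" by auto
    then have "card {e \<in> ?G. l \<in> e} \<le> 1"
      using card_mono[of "{if l \<le> m then ?g l else ?g (l - m)}"] by fastforce
    moreover have "(\<Sum>e\<in>{e \<in> edges ?M. l \<in> e}. w e) = (\<Sum>e\<in>{e \<in> ?G. l \<in> e}. 1)"
      using G by (intro sum.mono_neutral_cong_right) (auto simp: w_def finite_edges[OF V])
    ultimately show ?thesis by simp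
  qed
  have "(x, w) \<in> feasible1 ?M"
  proof -
    have "(\<Sum>l'\<in>pot1 ?M l. x (l, l')) = 0" if "l \<in> users ?M" for l
      using x0[OF that] by (intro sum.neutral) blast
    moreover have "x (l, l') + x (l', l) + w {l, l'} \<le> 1" if a: "(l, l') \<in> arcs ?M" for l l'
    proof -
      have "(l', l) \<in> arcs ?M" "{l, l'} \<in> edges ?M"
        using a by (auto simp: arcs_def edges_def users_def split: if_splits)
      with a show ?thesis by (simp add: x_def w_def)
    qed
    moreover have "x \<in> arcs ?M \<rightarrow>\<^sub>E {0, 1}" "w \<in> edges ?M \<rightarrow>\<^sub>E {0, 1}"
      by (auto simp: x_def w_def)
    ultimately show ?thesis
      using cap by (auto simp del: popular_market_simps(4) simp: feasible1_def)
  qed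
  from OPT_ge[OF V this] have "(\<Sum>e\<in>edges ?M. beta ?M 1 e * w e) \<le> OPT ?M"
    by (simp add: M2_eq_0[OF V] phi_popular_market_2)
  moreover have "(\<Sum>e\<in>edges ?M. beta ?M 1 e * w e) = (\<Sum>e\<in>?G. beta ?M 1 e)"
    using G by (intro sum.mono_neutral_cong_right) (auto simp: w_def finite_edges[OF V])
  moreover have "\<dots> = (\<Sum>i\<in>{1..m}. beta ?M 1 (?g i))"
    using inj by (simp add: sum.reindex)
  moreover have "\<dots> = (\<Sum>i\<in>{1..m}. 1/2)"
  proof (rule sum.cong)
    fix i assume i: "i \<in> {1..m}"
    \<comment> \<open>Of the two orientations, the one starting in \<open>I\<close> contributes 1/2
      and the reverse one contributes 1.\<close>
    have "{(l, l') \<in> arcs ?M. {l, l'} = ?g i} = {(i, i + m), (i + m, i)}"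
      using i mn by (auto simp: arcs_def users_def doubleton_eq_iff)
    then show "beta ?M 1 (?g i) = 1/2" using i by (simp add: beta_def)
  qed simp
  ultimately show ?thesis by simp
qed

text \<open>With an empty backlog, showing 0 to \<open>i\<close> is worth 1 and showing any other
  potential is worth 1/2. Under capacity 1 the strict gap excludes every other choice, so no
  tie-breaking rule can avoid 0.\<close>

lemma greedy_popular_market:
  assumes "greedy_choice (popular_market m n) 1 (pot1 (popular_market m n) i) {} i S"
    and i: "i \<in> {1..m}"
  shows "S \<subseteq> {0}"
proof
  fix j assume j: "j \<in> S"
  let ?v = "greedy_value (popular_market m n) 1 {} i"
  have S: "S \<subseteq> insert 0 {m<..<n}" "card S \<le> 1" and max: "\<not> ?v S < ?v {0}"
    using assms by (auto simp: greedy_choice_def is_arg_max_def)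
  then have "S = {j}"
    using j by (metis card_le_Suc0_iff_eq finite.insertI finite_greaterThanLessThan finite_subset
        One_nat_def is_singletonI' is_singleton_the_elem singletonD empty_iff)
  then show "j \<in> {0}"
    using max S i by (auto simp: greedy_value_def split: if_splits)
qed

text \<open>On an arc the coordinate is Bernoulli with parameter 0, whose support is
  \<open>False\<close> alone. Off the index set the product takes its default value, which is also
  \<open>False\<close>.\<close>

lemma like_pmf_never:
  assumes "valid_market M" "\<And>a. a \<in> arcs M \<Longrightarrow> phi M t a = 0" "\<omega> \<in> set_pmf (like_pmf M)"
  shows "\<not> \<omega> (t, a)"
proof
  assume *: "\<omega> (t, a)"
  have "\<omega> \<in> PiE_dflt ({1, 2} \<times> arcs M) False
      (set_pmf \<circ> (\<lambda>(t, a). bernoulli_pmf (phi M t a)))"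
    using assms(3) unfolding like_pmf_def
    by (subst (asm) set_Pi_pmf) (simp_all add: finite_arcs[OF assms(1)])
  then have "if (t, a) \<in> {1, 2} \<times> arcs M then \<omega> (t, a) \<in> set_pmf (bernoulli_pmf (phi M t a))
      else \<not> \<omega> (t, a)"
    unfolding PiE_dflt_def mem_Collect_eq by (drule_tac x = "(t, a)" in spec) auto
  then show False
    using * assms(2) by (auto simp: set_pmf_iff split: if_splits)
qed

text \<open>The bound holds for every outcome in the support, not just on average: the number of
  matches is at most the number of profiles shown to 0.\<close>

lemma expected_matches_popular_market_le:
  assumes "local_greedy (popular_market m n) S1 S2"
  shows "expected_matches (popular_market m n) S1 S2 \<le> 1"
proof -
  let ?M = "popular_market m n"
  have gr: "greedy_choice ?M 1 (pot1 ?M l) {} l (S1 l)" if "l \<in> users ?M" for l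
    using assms that by (simp add: local_greedy_def)
  have sub: "S1 l \<subseteq> pot1 ?M l" "card (S1 l) \<le> 1" if "l \<in> users ?M" for l
    using gr[OF that] by (auto simp: greedy_choice_def is_arg_max_def split: if_splits)
  have zero: "0 \<in> users ?M" by (simp add: users_def)
  have fin: "finite (S1 0)" using sub(1)[OF zero] finite_subset by fastforce
  have le: "card (matches ?M S1 S2 \<omega>) \<le> 1" if \<omega>: "\<omega> \<in> set_pmf (like_pmf ?M)" for \<omega>
  proof -
    have "\<not> \<omega> (2, a)" for a
      using like_pmf_never[OF valid_popular_market _ \<omega>] phi_popular_market_2 by blast
    then have "likes ?M \<omega> 2 S = {}" for S by (simp add: likes_def)
    then have "matches ?M S1 S2 \<omega> =
        {{l, l'} |l l'. (l, l') \<in> likes ?M \<omega> 1 S1 \<and> (l', l) \<in> likes ?M \<omega> 1 S1}"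
      by (simp add: matches_def Let_def)
    \<comment> \<open>From here on the like decisions are dropped; mutual display in period 1 alone
      limits the matches.\<close>
    also have "\<dots> \<subseteq> {{l, l'} |l l'. (l, l') \<in> shown ?M S1 \<and> (l', l) \<in> shown ?M S1}"
      by (auto simp: likes_def)
    also have "\<dots> \<subseteq> (\<lambda>i. {0, i}) ` S1 0"
    proof -
      \<comment> \<open>The endpoint in \<open>I\<close> was shown nobody but 0, so its partner is
        0, and mutual display places it in \<open>S1 0\<close>.\<close>
      have star: "{l, l'} \<in> (\<lambda>i. {0, i}) ` S1 0"
        if "l' \<in> S1 l" "l \<in> S1 l'" "l \<in> {1..m}" for l l'
      proof -
        have "l' = 0"
          using greedy_popular_market[OF gr] that by (auto simp: users_def)
        then show ?thesis using that by auto
      qed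
      \<comment> \<open>Displays only cross between the sides, so \<open>star\<close> applies to one
        of the two orientations of a mutually displayed pair.\<close>
      have sides: "l \<in> {1..m} \<or> l' \<in> {1..m}" if "l' \<in> S1 l" "l \<in> users ?M" for l l'
        using sub(1)[OF that(2)] that by (auto split: if_splits)
      show ?thesis
      proof clarify
        fix l l' assume "(l, l') \<in> shown ?M S1" "(l', l) \<in> shown ?M S1"
        then have *: "l' \<in> S1 l" "l \<in> S1 l'" "l \<in> users ?M" by (auto simp: shown_def)
        from sides[OF *(1,3)] show "{l, l'} \<in> (\<lambda>i. {0, i}) ` S1 0"
          using star[of l' l] star[of l l'] * by (metis insert_commute)
      qed
    qed
    finally have "card (matches ?M S1 S2 \<omega>) \<le> card (S1 0)"
      using fin surj_card_le by blast
    also have "\<dots> \<le> 1" using sub(2)[OF zero] .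
    finally show ?thesis .
  qed
  show ?thesis
    unfolding expected_matches_def using le
    by (intro measure_pmf.integral_le_const measure_pmf.integrable_const_bound[where B = 1])
       (auto simp: AE_measure_pmf_iff)
qed

theorem propositionD1:
  shows "\<exists>C::real. C > 0 \<and>
    (\<forall>\<^sub>F n in sequentially. \<exists>M :: nat market.
       valid_market M \<and> card (users M) = n \<and> OPT M > 0 \<and>
       (\<forall>S1 S2. local_greedy M S1 S2 \<longrightarrow>
          expected_matches M S1 S2 \<le> C / real n * OPT M))"
proof (intro exI conjI)
  show "\<forall>\<^sub>F n in sequentially. \<exists>M :: nat market.
       valid_market M \<and> card (users M) = n \<and> OPT M > 0 \<and>
       (\<forall>S1 S2. local_greedy M S1 S2 \<longrightarrow> expected_matches M S1 S2 \<le> 8 / real n * OPT M)"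
    using eventually_ge_at_top[of 4]
  proof eventually_elim
    fix n :: nat assume n: "4 \<le> n"
    \<comment> \<open>This is the largest \<open>m\<close> with 2m < n. As n \<ge> 4 gives m \<ge>
      1, it satisfies n \<le> 2m + 2 \<le> 4m. Together with the lower bound m/2 on
      \<open>OPT\<close> this yields n/8, the source of the constant 8.\<close>
    define m where "m = (n - 1) div 2"
    have m: "2 * m < n" "n \<le> 4 * m" using n by (auto simp: m_def)
    let ?M = "popular_market m n"
    have opt: "real n / 8 \<le> OPT ?M"
      using OPT_popular_market_ge[OF m(1)] m(2) by linarith
    then have "1 \<le> 8 / real n * OPT ?M"
      using n by (simp add: field_simps)
    then have "local_greedy ?M S1 S2 \<Longrightarrow> expected_matches ?M S1 S2 \<le> 8 / real n * OPT ?M" for S1 S2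
      using expected_matches_popular_market_le order_trans by blast
    moreover have "OPT ?M > 0" using opt n by linarith
    moreover have "card (users ?M) = n" using m by (simp add: users_popular_market)
    ultimately show "\<exists>M :: nat market.
       valid_market M \<and> card (users M) = n \<and> OPT M > 0 \<and>
       (\<forall>S1 S2. local_greedy M S1 S2 \<longrightarrow> expected_matches M S1 S2 \<le> 8 / real n * OPT M)"
      using valid_popular_market by blast
  qed
qed simp

end
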